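(* Let $m$ be a positive integer. For all integers $n,k\ge0$ we have \[ \mathrm{ac}_+^k(n,m)=\sum_{2i+j+r(m-1)+s+mc+md=n-2k}(-1)^r2^j\binom{i+k}{k}\binom{i}{j}\binom{j}{r}\binom{j+s-1}{s}\binom{k}{c}\binom{k+j+d-1}{d} \] and \[ \mathrm{ac}_+^k(n,m)=\sum_{\substack{i_0+i_1+\cdots+i_{m-2}=j\\ 2i+j+i_1+2i_2+\cdots+(m-2)i_{m-2}+mc+md=n-2k}}2^j\binom{i+k}{k}\binom{i}{j}\binom{j}{i_0,\ldots,i_{m-2}}\binom{k}{c}\binom{k+j+d-1}{d}. \]
   Context: A composition of $n$ is a finite sequence $\alpha=(\alpha_1,\ldots,\alpha_\ell)$ of positive integers with $\alpha_1+\cdots+\alpha_\ell=n$; the empty sequence ($\ell=0$) is the only composition of $0$. $\mathrm{ac}_+^k(n,m)$ is the number of compositions $\alpha=(\alpha_1,\ldots,\alpha_\ell)$ of $n$ such that $\#\{1\le i\le \ell/2:\alpha_i\equiv\alpha_{\ell+1-i}\pmod m\}=k$ and either $\ell$ is even, or $\ell$ is odd and the middle part $\alpha_{(\ell+1)/2}$ is even. Convention for binomial coefficients, for integers $a,b$: $\binom{a}{b}=\frac{a!}{b!(a-b)!}$ if $a\ge b\ge1$; $\binom{a}{b}=1$ if $b=0$ (for every integer $a$, including $a=-1$); $\binom{a}{b}=0$ otherwise. $\binom{j}{i_0,\ldots,i_{m-2}}=\frac{j!}{i_0!\cdots i_{m-2}!}$ is the multinomial coefficient. All summation indices (including $i_0,\ldots,i_{m-2}$)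 range over nonnegative integers; only finitely many terms are nonzero. When $m=1$ the list $i_0,\ldots,i_{m-2}$ is empty with empty sum $0$, so in the second sum only $j=0$ occurs, with multinomial coefficient $1$. *)

theory Defs
  imports "HOL-Number_Theory.Cong" "HOL-Library.Groups_Big_Fun"
begin

definition compositions :: "nat \<Rightarrow> nat list set" where
  "compositions n = {\<alpha>. (\<forall>a\<in>set \<alpha>. 0 < a) \<and> sum_list \<alpha> = n}"

text \<open>The parts are numbered from 1 in the definitions below, so the \<open>i\<close>-th part of \<open>\<alpha>\<close> is
  \<open>\<alpha> ! (i - 1)\<close> and its mirror image, the part number \<open>\<ell> + 1 - i\<close>, is \<open>\<alpha> ! (\<ell> - i)\<close>.\<close>

definition cong_pairs :: "nat \<Rightarrow> nat list \<Rightarrow> nat set" where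
  "cong_pairs m \<alpha> =
     {i. 1 \<le> i \<and> 2 * i \<le> length \<alpha> \<and> [\<alpha> ! (i - 1) = \<alpha> ! (length \<alpha> - i)] (mod m)}"

definition even_middle :: "nat list \<Rightarrow> bool" where
  "even_middle \<alpha> \<longleftrightarrow> even (length \<alpha>) \<or> even (\<alpha> ! ((length \<alpha> + 1) div 2 - 1))"

definition ac_plus :: "nat \<Rightarrow> nat \<Rightarrow> nat \<Rightarrow> nat" where
  "ac_plus k n m = card {\<alpha> \<in> compositions n. card (cong_pairs m \<alpha>) = k \<and> even_middle \<alpha>}"

text \<open>Binomial coefficients with integer arguments; \<open>ibinom a b\<close> vanishes for negative \<open>a\<close>
  unless \<open>b = 0\<close>, so this is not the generalised binomial coefficient.\<close>

definition ibinom :: "int \<Rightarrow> int \<Rightarrow> int" where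
  "ibinom a b =
     (if b = 0 then 1 else if 1 \<le> b \<and> b \<le> a then int (nat a choose nat b) else 0)"

text \<open>The division below is exact whenever \<open>sum_list xs = j\<close>, see \<open>multinom_exact\<close>.\<close>

definition multinom :: "nat \<Rightarrow> nat list \<Rightarrow> int" where
  "multinom j xs = fact j div prod_list (map fact xs)"

lemma prod_list_fact_dvd: "prod_list (map fact xs) dvd (fact (sum_list xs) :: int)"
proof (induction xs)
  case (Cons x xs)
  have "fact x * fact (sum_list xs) dvd (fact (x + sum_list xs) :: int)"
    by (rule fact_fact_dvd_fact)
  with Cons show ?case
    by (simp) (meson dvd_refl dvd_trans mult_dvd_mono)
qed simp

lemma multinom_exact:
  assumes "sum_list xs = j"
  shows "multinom j xs * prod_list (map fact xs) = fact j"
  using prod_list_fact_dvd[of xs] assms by (simp add: multinom_def)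

lemma finite_compositions: "finite (compositions n)"
proof (rule finite_subset)
  show "compositions n \<subseteq> {\<alpha>. set \<alpha> \<subseteq> {..n} \<and> length \<alpha> \<le> n}"
  proof
    fix \<alpha> assume a: "\<alpha> \<in> compositions n"
    have "length xs \<le> sum_list xs" if "\<forall>a\<in>set xs. 0 < a" for xs :: "nat list"
      using that by (induction xs) auto
    with a show "\<alpha> \<in> {\<alpha>. set \<alpha> \<subseteq> {..n} \<and> length \<alpha> \<le> n}"
      by (auto simp: compositions_def member_le_sum_list)
  qed
  show "finite {\<alpha>. set \<alpha> \<subseteq> {..n} \<and> length \<alpha> \<le> n}"
    by (rule finite_lists_length_le) simp
qed

text \<open>The multi-index sums are written with \<^const>\<open>Sum_any\<close>, which sums over the support of the
  summand but is 0 if that support is infinite. The next two lemmas show that the supports that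
  occur are finite. For \<open>m = 1\<close> the linear equation alone does not bound \<open>r\<close>.\<close>

lemma finite_support1:
  fixes N :: int
  assumes "0 < m"
  shows "finite {(i, j, r, s, c, d).
    2 * int i + int j + int r * (int m - 1) + int s + int m * int c + int m * int d = N
    \<and> ibinom (int j) (int r) \<noteq> 0}" (is "finite ?A")
proof (rule finite_subset)
  let ?B = "{..nat N}"
  show "?A \<subseteq> ?B \<times> ?B \<times> ?B \<times> ?B \<times> ?B \<times> ?B"
  proof
    fix x assume "x \<in> ?A"
    then obtain i j r s c d where x: "x = (i, j, r, s, c, d)"
      and e: "2 * int i + int j + int r * (int m - 1) + int s + int m * int c + int m * int d = N"
      and b: "ibinom (int j) (int r) \<noteq> 0"
      by auto
    have "int r * (int m - 1) \<ge> 0" "int c \<le> int m * int c" "int d \<le> int m * int d"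
      using assms by (auto simp: mult_le_cancel_right1)
    moreover have "r \<le> j"
      using b by (auto simp: ibinom_def split: if_splits)
    ultimately have "int i \<le> N" "int j \<le> N" "int r \<le> N" "int s \<le> N" "int c \<le> N" "int d \<le> N"
      using e by linarith+
    then have "i \<le> nat N" "j \<le> nat N" "r \<le> nat N" "s \<le> nat N" "c \<le> nat N" "d \<le> nat N"
      by linarith+
    then show "x \<in> ?B \<times> ?B \<times> ?B \<times> ?B \<times> ?B \<times> ?B"
      by (simp add: x)
  qed
qed simp

lemma finite_support2:
  fixes N :: int
  assumes "0 < m"
  shows "finite {(i, j, xs, c, d). length xs = m - 1 \<and> sum_list xs = j
    \<and> 2 * int i + int j + (\<Sum>l<m - 1. int l * int (xs ! l)) + int m * int c + int m * int d = N}"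
    (is "finite ?A")
proof (rule finite_subset)
  let ?B = "{..nat N}"
  let ?L = "{xs. set xs \<subseteq> ?B \<and> length xs = m - 1}"
  show "?A \<subseteq> ?B \<times> ?B \<times> ?L \<times> ?B \<times> ?B"
  proof
    fix x assume "x \<in> ?A"
    then obtain i j xs c d where x: "x = (i, j, xs, c, d)"
      and l: "length xs = m - 1" "sum_list xs = j"
      and e: "2 * int i + int j + (\<Sum>l<m - 1. int l * int (xs ! l)) + int m * int c + int m * int d = N"
      by auto
    have "(\<Sum>l<m - 1. int l * int (xs ! l)) \<ge> 0"
      by (intro sum_nonneg) simp
    moreover have "int c \<le> int m * int c" "int d \<le> int m * int d"
      using assms by (auto simp: mult_le_cancel_right1)
    ultimately have "int i \<le> N" "int j \<le> N" "int c \<le> N" "int d \<le> N"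
      using e by linarith+
    then have b: "i \<le> nat N" "j \<le> nat N" "c \<le> nat N" "d \<le> nat N"
      by linarith+
    have "y \<le> j" if "y \<in> set xs" for y
      using l that by (auto simp: member_le_sum_list)
    with b have "set xs \<subseteq> ?B"
      by (meson atMost_iff le_trans subsetI)
    with b l show "x \<in> ?B \<times> ?B \<times> ?L \<times> ?B \<times> ?B"
      by (simp add: x)
  qed
  show "finite (?B \<times> ?B \<times> ?L \<times> ?B \<times> ?B)"
    using finite_lists_length_eq[of ?B "m - 1"] by simp
qed

end

theory Submission
  imports Defs "HOL-Computational_Algebra.Formal_Power_Series"
begin

text \<open>Work with generating functions in \<open>q\<close>. A composition counted by \<^const>\<open>ac_plus\<close> is a nest of outer
pairs (first and last part, second and last but one, ...) around a core that is either empty or a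
single even part, so the core contributes \<open>1 / (1 - q^2)\<close>. Let \<open>C\<close> and \<open>N\<close> be the generating
functions, by \<open>a + b\<close>, of the pairs \<open>(a, b)\<close> of positive integers that are congruent modulo \<open>m\<close>,
respectively not congruent. Removing the outermost pair gives
\<open>A\<^sub>0 = 1 / (1 - q^2) + N A\<^sub>0\<close> and \<open>A\<^bsub>k+1\<^esub> = N A\<^bsub>k+1\<^esub> + C A\<^sub>k\<close> for the generating function \<open>A\<^sub>k\<close> of
\<open>ac_plus k n m\<close> over \<open>n\<close> (lemma \<open>ac_gf_recurrence\<close>), hence
\<open>A\<^sub>k = C^k / ((1 - q^2) (1 - N)^(k+1))\<close>.

A congruent pair is determined by its smaller part and its difference, a signed multiple of \<open>m\<close>;
therefore \<open>(1 - q^2) C = q^2 (1 + q^m) / (1 - q^m)\<close>. All pairs together give \<open>q^2 / (1 - q)^2\<close>, and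
subtraction yields \<open>(1 - q^2) (1 - N) = 1 - g\<close> with \<open>g = q^2 (1 + 2 q R / (1 - q^m))\<close> and
\<open>R = (1 - q^(m-1)) / (1 - q)\<close>. The powers of \<open>1 - q^2\<close> cancel and (lemma \<open>ac_gf_eq\<close>)
\<open>A\<^sub>k = q^(2k) ((1 + q^m) / (1 - q^m))^k / (1 - g)^(k+1)\<close>.

Both formulas are expansions of this product. The negative binomial series in \<open>g\<close> introduces \<open>i\<close>,
the binomial expansion of the \<open>i\<close>-th power of \<open>g / q^2\<close> introduces \<open>j\<close>, and \<open>(1 + q^m)^k\<close> and
\<open>1 / (1 - q^m)^(k+j)\<close> introduce \<open>c\<close> and \<open>d\<close> (lemma \<open>has_gf_expansion\<close>). The two formulas differ in the
treatment of \<open>R^j\<close>: expanding numerator and denominator separately gives the indices \<open>r\<close> and \<open>s\<close>,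
whereas \<open>R = 1 + q + \<dots> + q^(m-2)\<close> and the multinomial theorem give the list of the \<open>i\<^sub>l\<close>.\<close>

unbundle fps_syntax

section \<open>Weighted families and their generating functions\<close>

text \<open>The family of coefficients \<open>f a\<close> for \<open>a \<in> S\<close>, where \<open>f a\<close> sits in degree \<open>w a\<close>. Finiteness of each
degree is part of the notion, so an infinite index set never makes a sum collapse to 0. Since the
same relation describes a counted set (\<open>f = 1\<close>) and a multi-index sum, a change of summation
indices is a bijection between families.\<close>

definition has_gf :: "'a set \<Rightarrow> ('a \<Rightarrow> int) \<Rightarrow> ('a \<Rightarrow> nat) \<Rightarrow> int fps \<Rightarrow> bool" where
  "has_gf S f w F \<longleftrightarrow> (\<forall>n. finite {a\<in>S. w a = n} \<and> F $ n = (\<Sum>a | a \<in> S \<and> w a = n. f a))"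

lemma has_gf_finite: "has_gf S f w F \<Longrightarrow> finite {a\<in>S. w a = n}"
  and has_gf_nth: "has_gf S f w F \<Longrightarrow> F $ n = (\<Sum>a | a \<in> S \<and> w a = n. f a)"
  by (auto simp: has_gf_def)

lemma has_gf_unique: "has_gf S f w F \<Longrightarrow> has_gf S f w G \<Longrightarrow> F = G"
  by (simp add: fps_eq_iff has_gf_nth)

lemma has_gf_finite_le:
  assumes "has_gf S f w F"
  shows "finite {a\<in>S. w a \<le> n}"
proof -
  have "{a\<in>S. w a \<le> n} = (\<Union>t\<le>n. {a\<in>S. w a = t})"
    by auto
  then show ?thesis
    using has_gf_finite[OF assms] by simp
qed

lemma has_gf_Un:
  assumes "has_gf S f w F" "has_gf T f w G" "S \<inter> T = {}"
  shows "has_gf (S \<union> T) f w (F + G)"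
  unfolding has_gf_def
proof
  fix n
  have "{a \<in> S \<union> T. w a = n} = {a\<in>S. w a = n} \<union> {a\<in>T. w a = n}"
    by auto
  then show "finite {a \<in> S \<union> T. w a = n}
      \<and> (F + G) $ n = (\<Sum>a | a \<in> S \<union> T \<and> w a = n. f a)"
    using has_gf_finite[OF assms(1), of n] has_gf_finite[OF assms(2), of n] assms(3)
    by (simp add: has_gf_nth[OF assms(1)] has_gf_nth[OF assms(2)])
       (subst sum.union_disjoint[symmetric], auto)
qed

lemma has_gf_Diff:
  assumes "has_gf T f w G" "has_gf S f w F" "S \<subseteq> T"
  shows "has_gf (T - S) f w (G - F)"
  unfolding has_gf_def
proof
  fix n
  have "{a \<in> T - S. w a = n} = {a\<in>T. w a = n} - {a\<in>S. w a = n}"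
    by auto
  then show "finite {a \<in> T - S. w a = n}
      \<and> (G - F) $ n = (\<Sum>a | a \<in> T - S \<and> w a = n. f a)"
    using has_gf_finite[OF assms(1), of n] assms(3)
    by (simp add: has_gf_nth[OF assms(1)] has_gf_nth[OF assms(2)])
       (subst sum_diff, auto)
qed

lemma has_gf_shift:
  assumes F: "has_gf S f w F"
  shows "has_gf S f (\<lambda>a. c + w a) (fps_X ^ c * F)"
  unfolding has_gf_def
proof
  fix n
  show "finite {a\<in>S. c + w a = n} \<and> (fps_X ^ c * F) $ n = (\<Sum>a | a \<in> S \<and> c + w a = n. f a)"
  proof (cases "c \<le> n")
    case True
    then have "{a\<in>S. c + w a = n} = {a\<in>S. w a = n - c}"
      by auto
    with True show ?thesis
      by (simp add: fps_X_power_mult_nth has_gf_finite[OF F] has_gf_nth[OF F])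
  next
    case False
    then have "{a\<in>S. c + w a = n} = {}"
      by auto
    with False show ?thesis
      by (simp add: fps_X_power_mult_nth)
  qed
qed

lemma has_gf_bij:
  assumes "has_gf S f w F" and h: "bij_betw h S T"
    and "\<And>a. a \<in> S \<Longrightarrow> g (h a) = f a" "\<And>a. a \<in> S \<Longrightarrow> v (h a) = w a"
  shows "has_gf T g v F"
  unfolding has_gf_def
proof
  fix n
  have b: "bij_betw h {a\<in>S. w a = n} {b\<in>T. v b = n}"
    using h assms(4) by (auto simp: bij_betw_def inj_on_def)
  have "(\<Sum>b | b \<in> T \<and> v b = n. g b) = (\<Sum>a | a \<in> S \<and> w a = n. f a)"
    using assms(3) by (subst sum.reindex_bij_betw[OF b, symmetric]) auto
  then show "finite {b\<in>T. v b = n} \<and> F $ n = (\<Sum>b | b \<in> T \<and> v b = n. g b)"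
    using bij_betw_finite[OF b] assms(1) by (simp add: has_gf_def)
qed

text \<open>Nested sums: the series attached to an outer index may depend on that index. Only the coefficients
of the total series \<open>H\<close> are prescribed, which covers finite outer sums, Cauchy products and
composition of series alike.\<close>

lemma has_gf_Sigma:
  assumes fin: "\<And>n. finite {a\<in>S. w a \<le> n}"
    and G: "\<And>a. a \<in> S \<Longrightarrow> has_gf (T a) (g a) (v a) (G a)"
    and H: "\<And>n. H $ n = (\<Sum>a | a \<in> S \<and> w a \<le> n. f a * G a $ (n - w a))"
  shows "has_gf (Sigma S T) (\<lambda>(a, b). f a * g a b) (\<lambda>(a, b). w a + v a b) H"
  unfolding has_gf_def
proof
  fix n
  have eq: "{x \<in> Sigma S T. (case x of (a, b) \<Rightarrow> w a + v a b) = n}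
      = Sigma {a\<in>S. w a \<le> n} (\<lambda>a. {b\<in>T a. v a b = n - w a})"
    by auto
  have "H $ n = (\<Sum>a | a \<in> S \<and> w a \<le> n. \<Sum>b | b \<in> T a \<and> v a b = n - w a. f a * g a b)"
    by (auto simp: H sum_distrib_left has_gf_nth[OF G] intro!: sum.cong)
  also have "\<dots> = (\<Sum>x | x \<in> Sigma S T \<and> (case x of (a, b) \<Rightarrow> w a + v a b) = n.
      case x of (a, b) \<Rightarrow> f a * g a b)"
    unfolding eq by (rule sum.Sigma) (auto simp: fin has_gf_finite[OF G])
  finally show "finite {x \<in> Sigma S T. (case x of (a, b) \<Rightarrow> w a + v a b) = n} \<and>
      H $ n = (\<Sum>x | x \<in> Sigma S T \<and> (case x of (a, b) \<Rightarrow> w a + v a b) = n.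
        case x of (a, b) \<Rightarrow> f a * g a b)"
    unfolding eq by (auto intro!: finite_SigmaI simp: fin has_gf_finite[OF G])
qed

lemma has_gf_times:
  assumes F: "has_gf S f w F" and G: "has_gf T g v G"
  shows "has_gf (S \<times> T) (\<lambda>(a, b). f a * g b) (\<lambda>(a, b). w a + v b) (F * G)"
proof (rule has_gf_Sigma)
  show "finite {a\<in>S. w a \<le> n}" for n
    by (rule has_gf_finite_le[OF F])
  fix n
  have "(F * G) $ n = (\<Sum>t\<in>{0..n}. \<Sum>a | a \<in> {a\<in>S. w a \<le> n} \<and> w a = t. f a * G $ (n - w a))"
    unfolding fps_mult_nth has_gf_nth[OF F] sum_distrib_right
    by (intro sum.cong) auto
  also have "\<dots> = (\<Sum>a | a \<in> S \<and> w a \<le> n. f a * G $ (n - w a))"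
    by (rule sum.group) (auto simp: has_gf_finite_le[OF F])
  finally show "(F * G) $ n = (\<Sum>a | a \<in> S \<and> w a \<le> n. f a * G $ (n - w a))" .
qed (rule G)

lemma has_gf_Sigma_finite:
  assumes "finite S" and G: "\<And>a. a \<in> S \<Longrightarrow> has_gf (T a) (g a) (v a) (G a)"
  shows "has_gf (Sigma S T) (\<lambda>(a, b). f a * g a b) (\<lambda>(a, b). w a + v a b)
    (\<Sum>a\<in>S. fps_const (f a) * (fps_X ^ w a * G a))"
proof (rule has_gf_Sigma[OF _ G])
  show "finite {a\<in>S. w a \<le> n}" for n
    using assms(1) by simp
  show "(\<Sum>a\<in>S. fps_const (f a) * (fps_X ^ w a * G a)) $ n
      = (\<Sum>a | a \<in> S \<and> w a \<le> n. f a * G a $ (n - w a))" for n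
    using assms(1)
    by (auto simp: fps_sum_nth fps_X_power_mult_nth split: if_splits
        intro!: sum.mono_neutral_cong_right)
qed

text \<open>The binomial theorem as a rule for introducing a summation index. The factors \<open>Y ^ r * K\<close> are left
for further expansion.\<close>

lemma has_gf_binomial:
  assumes T: "\<And>r. r \<le> j \<Longrightarrow> has_gf (T r) (g r) (v r) (Y ^ r * K)"
  shows "has_gf (Sigma {..j} T) (\<lambda>(r, b). a ^ r * int (j choose r) * g r b)
    (\<lambda>(r, b). e * r + v r b) ((1 + fps_const a * fps_X ^ e * Y) ^ j * K)"
proof -
  have "has_gf (Sigma {..j} T) (\<lambda>(r, b). a ^ r * int (j choose r) * g r b)
    (\<lambda>(r, b). e * r + v r b)
    (\<Sum>r\<le>j. fps_const (a ^ r * int (j choose r)) * (fps_X ^ (e * r) * (Y ^ r * K)))"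
    by (rule has_gf_Sigma_finite) (auto intro: T)
  also have "(\<Sum>r\<le>j. fps_const (a ^ r * int (j choose r)) * (fps_X ^ (e * r) * (Y ^ r * K)))
      = (1 + fps_const a * fps_X ^ e * Y) ^ j * K"
    unfolding add.commute[of 1] binomial_ring sum_distrib_right
    by (simp add: power_mult_distrib mult_ac fps_of_nat
        flip: power_mult fps_const_mult fps_const_power)
  finally show ?thesis .
qed

text \<open>Substituting a series into a power series introduces an unbounded index. Here \<open>0 < c\<close> makes the sum
finite in each degree, because the \<open>i\<close>-th summand starts in degree at least \<open>c * i\<close>.\<close>

lemma has_gf_Sigma_compose:
  assumes "0 < c" and G: "\<And>i. has_gf (T i) (g i) (v i) (P ^ i * K)"
  shows "has_gf (Sigma UNIV T) (\<lambda>(i, b). a i * g i b) (\<lambda>(i, b). c * i + v i b)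
    ((Abs_fps a oo (fps_X ^ c * P)) * K)"
proof (rule has_gf_Sigma[OF _ G])
  have le: "i \<le> n" if "c * i \<le> n" for i n
    using that assms(1) by (metis One_nat_def Suc_leI le_trans mult_le_mono1 nat_mult_1)
  show "finite {i\<in>UNIV. c * i \<le> n}" for n
    by (rule finite_subset[of _ "{..n}"]) (auto intro: le)
  fix n
  let ?Q = "fps_X ^ c * P"
  have Q0: "?Q $ 0 = 0"
    using assms(1) by simp
  have "((Abs_fps a oo ?Q) * K) $ n = (\<Sum>t\<in>{0..n}. \<Sum>i\<in>{0..n}. a i * ?Q ^ i $ t * K $ (n - t))"
    unfolding fps_mult_nth fps_compose_nth fps_nth_Abs_fps sum_distrib_right
    using startsby_zero_power_prefix[OF Q0]
    by (intro sum.cong sum.mono_neutral_left) auto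
  also have "\<dots> = (\<Sum>i\<in>{0..n}. a i * (?Q ^ i * K) $ n)"
    by (subst sum.swap) (simp add: fps_mult_nth sum_distrib_left mult.assoc)
  also have "\<dots> = (\<Sum>i\<in>{0..n}. a i * (fps_X ^ (c * i) * (P ^ i * K)) $ n)"
    by (simp add: power_mult_distrib mult_ac flip: power_mult)
  also have "\<dots> = (\<Sum>i | i \<in> UNIV \<and> c * i \<le> n. a i * (P ^ i * K) $ (n - c * i))"
    by (rule sum.mono_neutral_cong_right) (auto simp: fps_X_power_mult_nth intro: le)
  finally show "((Abs_fps a oo ?Q) * K) $ n
      = (\<Sum>i | i \<in> UNIV \<and> c * i \<le> n. a i * (P ^ i * K) $ (n - c * i))" .
qed

lemma has_gf_compose:
  assumes "0 < c"
  shows "has_gf UNIV a (\<lambda>i. c * i) (Abs_fps a oo fps_X ^ c)"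
proof -
  \<comment> \<open>The powers of the inner factor 1 are the series of a one-point family.\<close>
  have "has_gf (UNIV \<times> {()}) (\<lambda>(i, b). a i * 1) (\<lambda>(i, b). c * i + 0)
      ((Abs_fps a oo (fps_X ^ c * 1)) * 1)"
    by (rule has_gf_Sigma_compose[OF assms]) (simp add: has_gf_def fps_one_nth)
  then show ?thesis
    unfolding mult_1_right by (rule has_gf_bij[where h = fst]) (auto simp: bij_betw_def inj_on_def)
qed

lemma has_gf_Sum_any:
  assumes "has_gf S f w F"
  shows "Sum_any (\<lambda>a. if a \<in> S \<and> w a = n then f a else 0) = F $ n"
proof -
  have "Sum_any (\<lambda>a. if a \<in> S \<and> w a = n then f a else 0)
      = (\<Sum>a\<in>{a\<in>S. w a = n}. if a \<in> S \<and> w a = n then f a else 0)"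
    by (rule Sum_any.expand_superset) (auto simp: has_gf_finite[OF assms])
  also have "\<dots> = F $ n"
    unfolding has_gf_nth[OF assms] by (rule sum.cong) auto
  finally show ?thesis .
qed

section \<open>Negative binomial series\<close>

text \<open>The coefficients of \<open>1 / (1 - q)^p\<close>. Truncated subtraction is harmless: it only affects \<open>p = d = 0\<close>,
where the coefficient is to be 1 and \<open>0 choose 0\<close> is.\<close>

definition negbin :: "nat \<Rightarrow> int fps" where
  "negbin p = Abs_fps (\<lambda>d. int (p + d - 1 choose d))"

lemma negbin_mult: "negbin p * (1 - fps_X) ^ p = 1"
proof (induction p)
  case 0
  show ?case
    by (auto simp: fps_eq_iff negbin_def fps_one_nth binomial_eq_0)
next
  case (Suc p)
  have "negbin (Suc p) * (1 - fps_X) = negbin p"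
  proof (rule fps_ext)
    fix d
    show "(negbin (Suc p) * (1 - fps_X)) $ d = negbin p $ d"
    proof (cases d)
      case (Suc e)
      then show ?thesis
        by (simp add: Suc algebra_simps negbin_def)
    qed (simp add: negbin_def)
  qed
  then show ?case
    using Suc by (simp flip: mult.assoc)
qed

lemma negbin_compose_mult:
  assumes "g $ 0 = 0"
  shows "(negbin p oo g) * (1 - g) ^ p = 1"
proof -
  have "(negbin p * (1 - fps_X) ^ p) oo g = 1"
    by (simp add: negbin_mult)
  then show ?thesis
    using assms by (simp add: fps_compose_mult_distrib fps_compose_sub_distrib flip: fps_compose_power)
qed

text \<open>The series \<open>1 / (1 - q^c)\<close>, for \<open>0 < c\<close>.\<close>

definition geom :: "nat \<Rightarrow> int fps" where
  "geom c = negbin 1 oo fps_X ^ c"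

lemma geom_mult: "0 < c \<Longrightarrow> geom c * (1 - fps_X ^ c) = 1"
  using negbin_compose_mult[of "fps_X ^ c" 1] by (simp add: geom_def)

lemma has_gf_geom: "0 < c \<Longrightarrow> has_gf UNIV (\<lambda>_. 1) (\<lambda>i. c * i) (geom c)"
  using has_gf_compose[of c "\<lambda>_. 1"] by (simp add: geom_def negbin_def)

lemma has_gf_geom_power:
  assumes "0 < c"
  shows "has_gf UNIV (\<lambda>d. int (p + d - 1 choose d)) (\<lambda>d. c * d) (geom c ^ p)"
proof -
  have X0: "(fps_X ^ c :: int fps) $ 0 = 0"
    using assms by simp
  have "geom c ^ p = (geom c ^ p * (1 - fps_X ^ c) ^ p) * (negbin p oo fps_X ^ c)"
    using negbin_compose_mult[OF X0, of p] by (simp add: mult_ac)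
  also have "\<dots> = negbin p oo fps_X ^ c"
    by (simp add: geom_mult[OF assms] flip: power_mult_distrib)
  finally have "geom c ^ p = negbin p oo fps_X ^ c" .
  then show ?thesis
    using has_gf_compose[OF assms] by (simp add: negbin_def)
qed

section \<open>Pairs of positive integers\<close>

definition pairs :: "(nat \<times> nat) set" where
  "pairs = {(a, b). 0 < a \<and> 0 < b}"

definition congruent_pairs :: "nat \<Rightarrow> (nat \<times> nat) set" where
  "congruent_pairs m = {(a, b)\<in>pairs. [a = b] (mod m)}"

abbreviation pair_sum :: "nat \<times> nat \<Rightarrow> nat" where
  "pair_sum \<equiv> \<lambda>(a, b). a + b"

lemma has_gf_pairs: "has_gf pairs (\<lambda>_. 1) pair_sum (fps_X ^ 2 * geom 1 ^ 2)"
proof -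
  have "has_gf (UNIV \<times> UNIV) (\<lambda>(t, u). 1 * 1) (\<lambda>(t, u). 1 * t + 1 * u) (geom 1 * geom 1)"
    by (intro has_gf_times has_gf_geom) auto
  from has_gf_shift[OF this, of 2] show ?thesis
    unfolding power2_eq_square
  proof (rule has_gf_bij[where h = "\<lambda>(t, u). (Suc t, Suc u)"])
    show "bij_betw (\<lambda>(t, u). (Suc t, Suc u)) (UNIV \<times> UNIV) pairs"
      by (rule bij_betw_byWitness[where f' = "\<lambda>(a, b). (a - 1, b - 1)"])
         (auto simp: pairs_def)
  qed auto
qed

text \<open>A congruent pair with \<open>a \<le> b\<close> is \<open>(t + 1, t + 1 + m u)\<close> for unique \<open>t\<close> and \<open>u\<close>, of sum \<open>2 + 2 t + m u\<close>;
a congruent pair with \<open>b < a\<close> is the mirror image of such a pair with \<open>u + 1\<close> instead of \<open>u\<close>, which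
accounts for the extra factor \<open>q^m\<close>.\<close>

lemma has_gf_congruent_pairs:
  assumes "0 < m"
  shows "has_gf (congruent_pairs m) (\<lambda>_. 1) pair_sum
    (fps_X ^ 2 * (1 + fps_X ^ m) * geom 2 * geom m)"
proof -
  let ?le = "{(a, b)\<in>congruent_pairs m. a \<le> b}"
  let ?gt = "{(a, b)\<in>congruent_pairs m. b < a}"
  have G: "has_gf (UNIV \<times> UNIV) (\<lambda>(t, u). 1 * 1) (\<lambda>(t, u). 2 * t + m * u) (geom 2 * geom m)"
    by (intro has_gf_times has_gf_geom assms) auto
  have dvd: "m dvd a - b \<longleftrightarrow> [a = b] (mod m)" if "b \<le> a" for a b
    using cong_altdef_nat[OF that] by simp
  have le: "has_gf ?le (\<lambda>_. 1) pair_sum (fps_X ^ 2 * (geom 2 * geom m))"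
    using has_gf_shift[OF G, of 2]
  proof (rule has_gf_bij[where h = "\<lambda>(t, u). (Suc t, Suc t + m * u)"])
    show "bij_betw (\<lambda>(t, u). (Suc t, Suc t + m * u)) (UNIV \<times> UNIV) ?le"
      by (rule bij_betw_byWitness[where f' = "\<lambda>(a, b). (a - 1, (b - a) div m)"])
         (use assms in \<open>auto simp: pairs_def congruent_pairs_def dvd cong_sym_eq cong_def\<close>)
  qed auto
  have inverse: "b + (m + m * ((a - b) div m - Suc 0)) = a"
    if ab: "b < a" "a mod m = b mod m" for a b
  proof -
    have "m dvd a - b"
      using ab dvd by (simp add: cong_def)
    then obtain u where u: "a - b = m * u"
      by blast
    with ab have "u \<noteq> 0"
      by (intro notI) simp
    then have "m * u = m + m * (u - Suc 0)"
      by (cases u) auto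
    with u ab assms show ?thesis
      by simp
  qed
  have add_mod: "Suc (t + (m + m * u)) mod m = Suc t mod m" for t u
    by (metis add_Suc mod_mult_self2 mult_Suc_right)
  have gt: "has_gf ?gt (\<lambda>_. 1) pair_sum (fps_X ^ (2 + m) * (geom 2 * geom m))"
    using has_gf_shift[OF G, of "2 + m"]
  proof (rule has_gf_bij[where h = "\<lambda>(t, u). (Suc t + m * Suc u, Suc t)"])
    show "bij_betw (\<lambda>(t, u). (Suc t + m * Suc u, Suc t)) (UNIV \<times> UNIV) ?gt"
      by (rule bij_betw_byWitness[where f' = "\<lambda>(a, b). (b - 1, (a - b) div m - 1)"])
         (use assms in \<open>auto simp: pairs_def congruent_pairs_def cong_def inverse add_mod\<close>)
  qed auto
  have "?le \<inter> ?gt = {}"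
    by auto
  then have "has_gf (?le \<union> ?gt) (\<lambda>_. 1) pair_sum
      (fps_X ^ 2 * (geom 2 * geom m) + fps_X ^ (2 + m) * (geom 2 * geom m))"
    by (rule has_gf_Un[OF le gt])
  moreover have "?le \<union> ?gt = congruent_pairs m"
    by auto
  ultimately show ?thesis
    by (simp add: algebra_simps power_add power2_eq_square)
qed

section \<open>Removing the outermost pair of a composition\<close>

text \<open>Adding an outer pair moves the pair number \<open>i\<close> to number \<open>i + 1\<close>, and the new pair is number 1.\<close>

lemma cong_pairs_sandwich:
  "cong_pairs m (a # \<beta> @ [b])
     = (if [a = b] (mod m) then {1} else {}) \<union> Suc ` cong_pairs m \<beta>"
proof -
  let ?\<alpha> = "a # \<beta> @ [b]"
  have "i \<in> cong_pairs m ?\<alpha> \<longleftrightarrow> i = 1 \<and> [a = b] (mod m) \<or> i \<in> Suc ` cong_pairs m \<beta>" for i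
  proof (cases "i \<le> 1")
    case True
    then show ?thesis
      by (cases "i = 0") (auto simp: cong_pairs_def nth_append)
  next
    case False
    then obtain e where i: "i = Suc (Suc e)"
      by (metis One_nat_def Suc_leI Suc_le_mono not_less_eq_eq old.nat.exhaust zero_less_Suc)
    show ?thesis
    proof (cases "2 * Suc e \<le> length \<beta>")
      case True
      then have "?\<alpha> ! (i - 1) = \<beta> ! e" "?\<alpha> ! (length ?\<alpha> - i) = \<beta> ! (length \<beta> - Suc e)"
        by (auto simp: i nth_append nth_Cons' Suc_diff_le)
      with True show ?thesis
        by (auto simp: cong_pairs_def i image_iff)
    next
      case False
      then show ?thesis
        by (auto simp: cong_pairs_def i)
    qed
  qed
  then show ?thesis
    by auto
qed

lemma finite_cong_pairs: "finite (cong_pairs m \<alpha>)"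
  by (rule finite_subset[of _ "{..length \<alpha>}"]) (auto simp: cong_pairs_def)

lemma card_cong_pairs_sandwich:
  "card (cong_pairs m (a # \<beta> @ [b]))
     = (if [a = b] (mod m) then 1 else 0) + card (cong_pairs m \<beta>)"
proof -
  have "1 \<notin> Suc ` cong_pairs m \<beta>"
    by (auto simp: cong_pairs_def)
  then show ?thesis
    by (simp add: cong_pairs_sandwich card_image finite_cong_pairs)
qed

lemma even_middle_sandwich: "even_middle (a # \<beta> @ [b]) \<longleftrightarrow> even_middle \<beta>"
proof (cases "even (length \<beta>)")
  case False
  then obtain e where "length \<beta> = Suc (2 * e)"
    by (auto elim: oddE)
  then show ?thesis
    by (simp add: even_middle_def nth_append)
qed (simp add: even_middle_def)

text \<open>The compositions behind \<^const>\<open>ac_plus\<close> with the total \<open>n\<close> left free, so that \<open>n\<close> can be used as weight.\<close>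

definition ac_plus_lists :: "nat \<Rightarrow> nat \<Rightarrow> nat list set" where
  "ac_plus_lists m k = {\<alpha>. (\<forall>a\<in>set \<alpha>. 0 < a) \<and> card (cong_pairs m \<alpha>) = k \<and> even_middle \<alpha>}"

definition ac_gf :: "nat \<Rightarrow> nat \<Rightarrow> int fps" where
  "ac_gf m k = Abs_fps (\<lambda>n. int (ac_plus k n m))"

lemma has_gf_ac: "has_gf (ac_plus_lists m k) (\<lambda>_. 1) sum_list (ac_gf m k)"
proof -
  have "{\<alpha> \<in> ac_plus_lists m k. sum_list \<alpha> = n}
      = {\<alpha> \<in> compositions n. card (cong_pairs m \<alpha>) = k \<and> even_middle \<alpha>}" for n
    by (auto simp: ac_plus_lists_def compositions_def)
  then show ?thesis
    by (simp add: has_gf_def ac_gf_def ac_plus_def finite_compositions)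
qed

text \<open>The possible cores: the empty list and the single even parts.\<close>

lemma has_gf_short:
  "has_gf {\<alpha>\<in>ac_plus_lists m 0. length \<alpha> \<le> 1} (\<lambda>_. 1) sum_list (geom 2)"
proof -
  have "has_gf UNIV (\<lambda>_. 1) (\<lambda>t. 2 * t) (geom 2)"
    by (rule has_gf_geom) simp
  then show ?thesis
  proof (rule has_gf_bij[where h = "\<lambda>t. if t = 0 then [] else [2 * t]"])
    have "cong_pairs m \<alpha> = {}" if "length \<alpha> \<le> 1" for \<alpha>
      using that by (auto simp: cong_pairs_def)
    then show "bij_betw (\<lambda>t. if t = 0 then [] else [2 * t]) UNIV
        {\<alpha>\<in>ac_plus_lists m 0. length \<alpha> \<le> 1}"
      by (intro bij_betw_byWitness[where f' = "\<lambda>\<alpha>. sum_list \<alpha> div 2"])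
         (auto simp: ac_plus_lists_def even_middle_def le_Suc_eq length_Suc_conv)
  qed auto
qed

lemma short_empty: "{\<alpha>\<in>ac_plus_lists m (Suc k). length \<alpha> \<le> 1} = {}"
proof -
  have "cong_pairs m \<alpha> = {}" if "length \<alpha> \<le> 1" for \<alpha>
    using that by (auto simp: cong_pairs_def)
  then show ?thesis
    by (auto simp: ac_plus_lists_def)
qed

lemma list_sandwich:
  assumes "1 < length \<alpha>"
  obtains a \<beta> b where "\<alpha> = a # \<beta> @ [b]"
proof (cases \<alpha>)
  case (Cons a \<gamma>)
  with assms show ?thesis
    using that[of a "butlast \<gamma>" "last \<gamma>"] by (cases \<gamma>) auto
qed (use assms in simp)

lemma has_gf_sandwich:
  assumes P: "has_gf P (\<lambda>_. 1) pair_sum F" and S: "has_gf S (\<lambda>_. 1) sum_list G"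
  shows "has_gf {a # \<beta> @ [b] |a b \<beta>. (a, b) \<in> P \<and> \<beta> \<in> S} (\<lambda>_. 1) sum_list (F * G)"
  using has_gf_times[OF P S]
proof (rule has_gf_bij[where h = "\<lambda>((a, b), \<beta>). a # \<beta> @ [b]"])
  show "bij_betw (\<lambda>((a, b), \<beta>). a # \<beta> @ [b]) (P \<times> S)
      {a # \<beta> @ [b] |a b \<beta>. (a, b) \<in> P \<and> \<beta> \<in> S}"
    by (force simp: bij_betw_def inj_on_def)
qed auto

lemma ac_plus_lists_decomp:
  "ac_plus_lists m k = {\<alpha>\<in>ac_plus_lists m k. length \<alpha> \<le> 1} \<union>
     ({a # \<beta> @ [b] |a b \<beta>. (a, b) \<in> pairs - congruent_pairs m \<and> \<beta> \<in> ac_plus_lists m k} \<union>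
      {a # \<beta> @ [b] |a b \<beta>. (a, b) \<in> congruent_pairs m \<and> 0 < k \<and> \<beta> \<in> ac_plus_lists m (k - 1)})"
    (is "_ = ?short \<union> (?N \<union> ?C)")
proof (intro set_eqI iffI)
  fix \<alpha> assume \<alpha>: "\<alpha> \<in> ac_plus_lists m k"
  show "\<alpha> \<in> ?short \<union> (?N \<union> ?C)"
  proof (cases "length \<alpha> \<le> 1")
    case False
    then obtain a \<beta> b where "\<alpha> = a # \<beta> @ [b]"
      using list_sandwich[of \<alpha>] by auto
    with \<alpha> show ?thesis
      by (auto simp: ac_plus_lists_def pairs_def congruent_pairs_def card_cong_pairs_sandwich
          even_middle_sandwich split: if_splits)
  qed (use \<alpha> in simp)
next
  fix \<alpha> assume "\<alpha> \<in> ?short \<union> (?N \<union> ?C)"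
  then show "\<alpha> \<in> ac_plus_lists m k"
    by (auto simp: ac_plus_lists_def pairs_def congruent_pairs_def card_cong_pairs_sandwich
          even_middle_sandwich)
qed

lemma has_gf_noncongruent_pairs:
  assumes "0 < m"
  shows "has_gf (pairs - congruent_pairs m) (\<lambda>_. 1) pair_sum
    (fps_X ^ 2 * geom 1 ^ 2 - fps_X ^ 2 * (1 + fps_X ^ m) * geom 2 * geom m)"
  by (rule has_gf_Diff[OF has_gf_pairs has_gf_congruent_pairs[OF assms]])
     (auto simp: congruent_pairs_def)

text \<open>The outermost pair encloses a composition of the same kind (possibly empty). Removing it lowers the
number of congruent pairs by one exactly when it is itself congruent.\<close>

lemma ac_gf_recurrence:
  assumes C: "has_gf (congruent_pairs m) (\<lambda>_. 1) pair_sum C"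
    and N: "has_gf (pairs - congruent_pairs m) (\<lambda>_. 1) pair_sum N"
  shows "ac_gf m 0 = geom 2 + N * ac_gf m 0"
    and "ac_gf m (Suc k) = N * ac_gf m (Suc k) + C * ac_gf m k"
proof -
  let ?N = "\<lambda>k. {a # \<beta> @ [b] |a b \<beta>. (a, b) \<in> pairs - congruent_pairs m \<and> \<beta> \<in> ac_plus_lists m k}"
  let ?C = "\<lambda>k. {a # \<beta> @ [b] |a b \<beta>. (a, b) \<in> congruent_pairs m \<and> \<beta> \<in> ac_plus_lists m k}"
  let ?short = "{\<alpha>\<in>ac_plus_lists m 0. length \<alpha> \<le> 1}"
  have Ngf: "has_gf (?N k) (\<lambda>_. 1) sum_list (N * ac_gf m k)" for k
    by (rule has_gf_sandwich[OF N has_gf_ac])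
  have Cgf: "has_gf (?C k) (\<lambda>_. 1) sum_list (C * ac_gf m k)" for k
    by (rule has_gf_sandwich[OF C has_gf_ac])
  have "ac_plus_lists m 0 = ?short \<union> ?N 0"
    by (subst ac_plus_lists_decomp) auto
  moreover have "has_gf (?short \<union> ?N 0) (\<lambda>_. 1) sum_list (geom 2 + N * ac_gf m 0)"
    by (rule has_gf_Un[OF has_gf_short Ngf]) auto
  ultimately show "ac_gf m 0 = geom 2 + N * ac_gf m 0"
    using has_gf_unique[OF has_gf_ac] by metis
  have "ac_plus_lists m (Suc k) = ?N (Suc k) \<union> ?C k"
    by (subst ac_plus_lists_decomp, subst short_empty) auto
  moreover have "has_gf (?N (Suc k) \<union> ?C k) (\<lambda>_. 1) sum_list
      (N * ac_gf m (Suc k) + C * ac_gf m k)"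
    by (rule has_gf_Un[OF Ngf Cgf]) auto
  ultimately show "ac_gf m (Suc k) = N * ac_gf m (Suc k) + C * ac_gf m k"
    using has_gf_unique[OF has_gf_ac] by metis
qed

section \<open>Closed form of the generating function\<close>

text \<open>With \<open>g = 1 / (1 - x)\<close>, \<open>h = 1 / (1 - x z)\<close>, \<open>x = q\<close> and \<open>x z = q^m\<close>, the left-hand side is the
difference between all pairs and congruent pairs, up to the factor \<open>q^2 / (1 - q^2)\<close>.\<close>

lemma noncongruent_identity:
  fixes x z g h :: "'a::idom"
  assumes "g * (1 - x) = 1" "h * (1 - x * z) = 1"
  shows "(1 + x) * g - (1 + x * z) * h = 2 * x * ((1 - z) * g) * h"
  using assms by algebra

text \<open>The recurrences give \<open>A\<^sub>k (1 - N)^(k+1) (1 - q^2) = C^k\<close>. Multiplication by \<open>(1 - q^2)^k\<close> pairs each factor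
\<open>1 - N\<close> and each factor \<open>C\<close> with one \<open>1 - q^2\<close>, which turns them into \<open>1 - g\<close> and into a series with
denominator \<open>1 - q^m\<close> only.\<close>

lemma ac_gf_eq:
  assumes "0 < m"
  defines "g \<equiv> fps_X ^ 2 * (1 + 2 * fps_X * ((1 - fps_X ^ (m - 1)) * geom 1) * geom m)"
  shows "ac_gf m k
    = fps_X ^ (2 * k) * ((negbin (k + 1) oo g) * ((1 + fps_X ^ m) ^ k * geom m ^ k))"
proof -
  define C where "C = fps_X ^ 2 * (1 + fps_X ^ m) * geom 2 * geom m"
  define N where "N = fps_X ^ 2 * geom 1 ^ 2 - C"
  define M where "M = (1 + fps_X ^ m) * geom m"
  have g1: "geom 1 * (1 - fps_X) = 1" and g2: "geom 2 * (1 - fps_X ^ 2) = 1"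
    and gm: "geom m * (1 - fps_X ^ m) = 1"
    using geom_mult[of 1] geom_mult[of 2] geom_mult[OF assms(1)] by simp_all
  have Xm: "fps_X ^ m = (fps_X * fps_X ^ (m - 1) :: int fps)"
    using assms(1) by (cases m) auto
  have "C * (1 - fps_X ^ 2) = (geom 2 * (1 - fps_X ^ 2)) * (fps_X ^ 2 * M)"
    by (simp only: C_def M_def mult_ac)
  then have C: "C * (1 - fps_X ^ 2) = fps_X ^ 2 * M"
    by (simp add: g2)
  have "(1 - fps_X ^ 2) * geom 1 ^ 2 = (1 + fps_X) * geom 1"
    using g1 by algebra
  moreover have "N * (1 - fps_X ^ 2) = fps_X ^ 2 * ((1 - fps_X ^ 2) * geom 1 ^ 2) - fps_X ^ 2 * M"
    unfolding N_def C[symmetric] by algebra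
  ultimately have "N * (1 - fps_X ^ 2) = fps_X ^ 2 * ((1 + fps_X) * geom 1 - M)"
    by (simp add: right_diff_distrib)
  also have "(1 + fps_X) * geom 1 - M
      = 2 * fps_X * ((1 - fps_X ^ (m - 1)) * geom 1) * geom m"
    unfolding M_def Xm by (rule noncongruent_identity) (use g1 gm in \<open>simp_all add: Xm\<close>)
  finally have N: "(1 - N) * (1 - fps_X ^ 2) = 1 - g"
    by (simp add: g_def algebra_simps)
  have rec: "ac_gf m 0 * (1 - N) = geom 2"
    "ac_gf m (Suc k) * (1 - N) = C * ac_gf m k" for k
    using ac_gf_recurrence[OF has_gf_congruent_pairs has_gf_noncongruent_pairs] assms(1)
    by (simp_all add: C_def N_def algebra_simps)
  have "ac_gf m k * (1 - g) ^ (k + 1) = (fps_X ^ 2 * M) ^ k"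
  proof (induction k)
    case 0
    have "ac_gf m 0 * (1 - g) = ac_gf m 0 * (1 - N) * (1 - fps_X ^ 2)"
      by (simp only: mult.assoc flip: N)
    also have "\<dots> = 1"
      unfolding rec(1) by (rule g2)
    finally show ?case
      by simp
  next
    case (Suc k)
    have "ac_gf m (Suc k) * (1 - g) ^ (Suc k + 1)
        = (ac_gf m (Suc k) * (1 - N)) * (1 - fps_X ^ 2) * (1 - g) ^ (k + 1)"
      by (simp add: mult_ac flip: N)
    also have "\<dots> = (C * (1 - fps_X ^ 2)) * (ac_gf m k * (1 - g) ^ (k + 1))"
      unfolding rec(2) by (simp add: mult_ac)
    finally show ?case
      unfolding C Suc by simp
  qed
  moreover have inv: "(negbin (k + 1) oo g) * (1 - g) ^ (k + 1) = 1"
    by (rule negbin_compose_mult) (simp add: g_def)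
  have "ac_gf m k * (1 - g) ^ (k + 1) * (negbin (k + 1) oo g)
      = ac_gf m k * ((negbin (k + 1) oo g) * (1 - g) ^ (k + 1))"
    by (simp only: mult_ac)
  then have "ac_gf m k = ac_gf m k * (1 - g) ^ (k + 1) * (negbin (k + 1) oo g)"
    unfolding inv by simp
  ultimately have "ac_gf m k = (fps_X ^ 2 * M) ^ k * (negbin (k + 1) oo g)"
    by simp
  then show ?thesis
    by (simp add: M_def power_mult_distrib mult_ac flip: power_mult)
qed

section \<open>Expansion into multi-index sums\<close>

lemma has_gf_congruent_part:
  assumes "0 < m"
  shows "has_gf ({..k} \<times> UNIV)
    (\<lambda>(c, d). int (k choose c) * int (k + j + d - 1 choose d)) (\<lambda>(c, d). m * c + m * d)
    ((1 + fps_X ^ m) ^ k * geom m ^ (k + j))"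
  using has_gf_binomial[of k "\<lambda>_. UNIV" "\<lambda>_ d. int (k + j + d - 1 choose d)" "\<lambda>_ d. m * d" 1
      "geom m ^ (k + j)" 1 m] has_gf_geom_power[OF assms, of "k + j"]
  by simp

lemma sum_fps_X_power: "(\<Sum>l<M. fps_X ^ l) = (1 - fps_X ^ M) * geom 1"
proof -
  have "(\<Sum>l<M. fps_X ^ l) = (\<Sum>l<M. fps_X ^ l) * ((1 - fps_X) * geom 1)"
    using geom_mult[of 1] by (simp add: mult.commute)
  also have "\<dots> = (1 - fps_X ^ M) * geom 1"
    unfolding one_diff_power_eq by (simp add: mult_ac)
  finally show ?thesis .
qed

lemma multinom_snoc:
  assumes "t \<le> j" "sum_list xs = j - t"
  shows "multinom j (xs @ [t]) = int (j choose t) * multinom (j - t) xs"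
proof -
  have "sum_list (xs @ [t]) = j"
    using assms by simp
  then have "multinom j (xs @ [t]) * (prod_list (map fact xs) * fact t) = fact j"
    using multinom_exact[of "xs @ [t]" j] by simp
  also have "(fact j :: int) = int (j choose t) * (fact t * fact (j - t))"
    using binomial_fact_lemma[OF assms(1)] by (metis mult.commute of_nat_fact of_nat_mult)
  also have "\<dots> = int (j choose t) * multinom (j - t) xs * (prod_list (map fact xs) * fact t)"
    using multinom_exact[OF assms(2)] by (simp add: mult_ac)
  finally show ?thesis
    by (auto simp: prod_list_zero_iff)
qed

text \<open>The multinomial theorem for \<open>1 + q + \<dots> + q^(M-1)\<close>, by induction on \<open>M\<close>: the exponent \<open>t\<close> of the new term
\<open>q^M\<close> is split off by the binomial theorem and appended to the list. For \<open>M = 0\<close> the empty list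
survives only for \<open>j = 0\<close>, in accordance with \<open>0 ^ j\<close>.\<close>

lemma has_gf_multinom:
  "has_gf {xs. length xs = M \<and> sum_list xs = j} (multinom j) (\<lambda>xs. \<Sum>l<M. l * xs ! l)
     ((\<Sum>l<M. fps_X ^ l) ^ j)"
proof (induction M arbitrary: j)
  case 0
  show ?case
  proof (cases "j = 0")
    case True
    then have "{xs. length xs = 0 \<and> sum_list xs = j} = {[]}"
      by auto
    with True show ?thesis
      by (simp add: has_gf_def multinom_def Collect_conv_if)
  next
    case False
    then have "{xs. length xs = 0 \<and> sum_list xs = j} = {}"
      by auto
    with False show ?thesis
      by (auto simp: has_gf_def power_0_left intro!: sum.neutral)
  qed
next
  case (Suc M)
  let ?T = "\<lambda>t. {xs. length xs = M \<and> sum_list xs = j - t}"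
  let ?w = "\<lambda>M xs. \<Sum>l<M. l * xs ! l :: nat"
  have "has_gf (Sigma {..j} ?T)
      (\<lambda>(t, xs). int (j choose t) * multinom (j - t) xs) (\<lambda>(t, xs). M * t + ?w M xs)
      (\<Sum>t\<le>j. fps_const (int (j choose t)) * (fps_X ^ (M * t) * (\<Sum>l<M. fps_X ^ l) ^ (j - t)))"
    by (rule has_gf_Sigma_finite[where w = "\<lambda>t. M * t" and f = "\<lambda>t. int (j choose t)"
          and G = "\<lambda>t. (\<Sum>l<M. fps_X ^ l) ^ (j - t)"]) (rule finite_atMost, rule Suc)
  also have "(\<Sum>t\<le>j. fps_const (int (j choose t)) * (fps_X ^ (M * t) * (\<Sum>l<M. fps_X ^ l) ^ (j - t)))
      = (\<Sum>l<Suc M. fps_X ^ l) ^ j"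
    unfolding sum.lessThan_Suc add.commute[of _ "fps_X ^ M"] binomial_ring
    by (simp add: power_mult mult.assoc fps_of_nat)
  finally show ?case
  proof (rule has_gf_bij[where h = "\<lambda>(t, xs). xs @ [t]"])
    show "bij_betw (\<lambda>(t, xs). xs @ [t]) (Sigma {..j} ?T)
        {xs. length xs = Suc M \<and> sum_list xs = j}"
      by (rule bij_betw_byWitness[where f' = "\<lambda>ys. (last ys, butlast ys)"])
         (auto simp: length_Suc_conv_rev)
  qed (auto simp: multinom_snoc nth_append)
qed

text \<open>The common part of both formulas. The expansion of \<open>R ^ j\<close> is a parameter; it comes multiplied with
all factors that have to be expanded after \<open>j\<close> is fixed, since the exponent of \<open>geom m\<close> depends on \<open>j\<close>.\<close>

lemma has_gf_expansion:
  assumes T: "\<And>j. has_gf (T j) (g j) (v j) (R ^ j * ((1 + fps_X ^ m) ^ k * geom m ^ (k + j)))"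
  shows "has_gf (Sigma UNIV (\<lambda>i. Sigma {..i} T))
    (\<lambda>(i, j, b). int (k + i choose i) * (2 ^ j * int (i choose j) * g j b))
    (\<lambda>(i, j, b). 2 * i + (j + v j b))
    ((negbin (k + 1) oo (fps_X ^ 2 * (1 + 2 * fps_X * R * geom m)))
       * ((1 + fps_X ^ m) ^ k * geom m ^ k))"
proof -
  let ?K = "(1 + fps_X ^ m) ^ k * geom m ^ k"
  let ?f = "\<lambda>i (j, b). 2 ^ j * int (i choose j) * g j b"
  let ?w = "\<lambda>(j, b). j + v j b"
  have eq: "(R * geom m) ^ j * ?K = R ^ j * ((1 + fps_X ^ m) ^ k * geom m ^ (k + j))" for j
    by (simp add: power_mult_distrib power_add mult_ac)
  have "has_gf (T j) (g j) (v j) ((R * geom m) ^ j * ?K)" for j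
    unfolding eq by (rule T)
  then have "has_gf (Sigma {..i} T) (?f i) ?w
      ((1 + fps_const 2 * fps_X ^ 1 * (R * geom m)) ^ i * ?K)" for i
    using has_gf_binomial[of i T g v "R * geom m" ?K 2 1] by simp
  then have "has_gf (Sigma {..i} T) (?f i) ?w ((1 + 2 * fps_X * R * geom m) ^ i * ?K)" for i
    by (simp add: numeral_fps_const mult.assoc)
  then have "has_gf (Sigma UNIV (\<lambda>i. Sigma {..i} T))
    (\<lambda>(i, b). int (k + i choose i) * ?f i b) (\<lambda>(i, b). 2 * i + ?w b)
    ((Abs_fps (\<lambda>i. int (k + i choose i)) oo (fps_X ^ 2 * (1 + 2 * fps_X * R * geom m))) * ?K)"
    by (intro has_gf_Sigma_compose) auto
  then show ?thesis
    by (simp add: negbin_def case_prod_unfold)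
qed

section \<open>The two formulas\<close>

lemma ibinom_of_nat [simp]: "ibinom (int a) (int b) = int (a choose b)"
  by (auto simp: ibinom_def binomial_eq_0)

text \<open>For \<open>p = d = 0\<close> the upper argument is \<open>-1\<close>, and both sides are 1.\<close>

lemma ibinom_negbin [simp]: "ibinom (int p + int d - 1) (int d) = int (p + d - 1 choose d)"
  by (cases "p + d") (auto simp: ibinom_def binomial_eq_0 nat_diff_distrib nat_add_distrib)

text \<open>Reads off the coefficient of \<open>q^n\<close>. For \<open>n < 2 * k\<close> the weight equation has a negative right-hand side
and no solutions, matching the factor \<open>q^(2k)\<close>.\<close>

lemma ac_plus_Sum_any:
  assumes "has_gf S f w F" and "ac_gf m k = fps_X ^ (2 * k) * F"
    and "\<And>a. h a = (if a \<in> S \<and> int (w a) = int n - 2 * int k then f a else 0)"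
  shows "int (ac_plus k n m) = Sum_any h"
proof -
  have "int (ac_plus k n m) = (fps_X ^ (2 * k) * F) $ n"
    by (simp add: ac_gf_def flip: assms(2))
  also have "\<dots> = Sum_any h"
  proof (cases "2 * k \<le> n")
    case True
    have "h = (\<lambda>a. if a \<in> S \<and> w a = n - 2 * k then f a else 0)"
      using True by (auto simp: assms(3) fun_eq_iff)
    with True show ?thesis
      by (simp add: fps_X_power_mult_nth has_gf_Sum_any[OF assms(1)])
  next
    case False
    then have "h = (\<lambda>_. 0)"
      by (auto simp: assms(3) fun_eq_iff)
    with False show ?thesis
      by (simp add: fps_X_power_mult_nth)
  qed
  finally show ?thesis .
qed

theorem theorem6p1:
  fixes m n k :: nat
  assumes "0 < m"
  shows "(int (ac_plus k n m) =
      Sum_any (\<lambda>(i::nat, j::nat, r::nat, s::nat, c::nat, d::nat).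
        if 2 * int i + int j + int r * (int m - 1) + int s + int m * int c + int m * int d
             = int n - 2 * int k
        then (- 1) ^ r * 2 ^ j * ibinom (int i + int k) (int k) * ibinom (int i) (int j)
             * ibinom (int j) (int r) * ibinom (int j + int s - 1) (int s)
             * ibinom (int k) (int c) * ibinom (int k + int j + int d - 1) (int d)
        else 0))
    \<and> (int (ac_plus k n m) =
      Sum_any (\<lambda>(i::nat, j::nat, xs::nat list, c::nat, d::nat).
        if length xs = m - 1 \<and> sum_list xs = j \<and>
           2 * int i + int j + (\<Sum>l<m - 1. int l * int (xs ! l)) + int m * int c + int m * int d
             = int n - 2 * int k
        then 2 ^ j * ibinom (int i + int k) (int k) * ibinom (int i) (int j)
             * multinom j xs
             * ibinom (int k) (int c) * ibinom (int k + int j + int d - 1) (int d)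
        else 0))"
proof -
  let ?R = "(1 - fps_X ^ (m - 1)) * geom 1"
  let ?L = "\<lambda>j. (1 + fps_X ^ m) ^ k * geom m ^ (k + j)"
  let ?f = "\<lambda>j (c, d). int (k choose c) * int (k + j + d - 1 choose d)"
  let ?w = "\<lambda>(c, d). m * c + m * d"
  have L: "has_gf ({..k} \<times> UNIV) (?f j) ?w (?L j)" for j
    by (rule has_gf_congruent_part[OF assms])
  have b1: "ibinom (int i + int k) (int k) = int (k + i choose i)" for i
    using ibinom_of_nat[of "i + k" k] by (simp add: binomial_symmetric[of k "i + k"] add.commute)
  have b2: "ibinom (int k + int j + int d - 1) (int d) = int (k + j + d - 1 choose d)" for j d
    using ibinom_negbin[of "k + j" d] by simp

  have "has_gf ({..j} \<times> UNIV \<times> {..k} \<times> UNIV)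
      (\<lambda>(r, s, b). (-1) ^ r * int (j choose r) * (int (j + s - 1 choose s) * ?f j b))
      (\<lambda>(r, s, b). (m - 1) * r + (1 * s + ?w b))
      (?R ^ j * ?L j)" for j
  proof -
    have "has_gf (UNIV \<times> {..k} \<times> UNIV)
        (\<lambda>(s, b). int (j + s - 1 choose s) * ?f j b) (\<lambda>(s, b). 1 * s + ?w b)
        (1 ^ r * (geom 1 ^ j * ?L j))" for r
      using has_gf_times[OF has_gf_geom_power[of 1 j] L[of j]] by simp
    from has_gf_binomial[OF this, of j "-1" "m - 1"] show ?thesis
      by (simp add: power_mult_distrib mult.assoc case_prod_unfold flip: fps_const_neg)
  qed
  note first = ac_plus_Sum_any[OF has_gf_expansion[OF this] ac_gf_eq[OF assms]]

  have "has_gf ({xs. length xs = m - 1 \<and> sum_list xs = j} \<times> {..k} \<times> UNIV)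
      (\<lambda>(xs, b). multinom j xs * ?f j b)
      (\<lambda>(xs, b). (\<Sum>l<m - 1. l * xs ! l) + ?w b)
      (?R ^ j * ?L j)" for j
    unfolding sum_fps_X_power[symmetric] by (intro has_gf_times has_gf_multinom L)
  note second = ac_plus_Sum_any[OF has_gf_expansion[OF this] ac_gf_eq[OF assms]]

  show ?thesis
  proof (intro conjI first second, goal_cases)
    case (1 x)
    obtain i j r s c d where x: "x = (i, j, r, s, c, d)"
      by (cases x)
    have "int (2 * i + (j + ((m - 1) * r + (1 * s + (m * c + m * d)))))
        = 2 * int i + int j + int r * (int m - 1) + int s + int m * int c + int m * int d"
      using assms by (cases m) (simp_all add: algebra_simps)
    then show ?case
      unfolding x by (auto simp: b1 b2 binomial_eq_0 simp del: of_nat_add of_nat_mult)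
  next
    case (2 x)
    obtain i j xs c d where x: "x = (i, j, xs, c, d)"
      by (cases x)
    have "int (2 * i + (j + ((\<Sum>l<m - 1. l * xs ! l) + (m * c + m * d))))
        = 2 * int i + int j + (\<Sum>l<m - 1. int l * int (xs ! l)) + int m * int c + int m * int d"
      by simp
    then show ?case
      unfolding x by (auto simp: b1 b2 binomial_eq_0 simp del: of_nat_add of_nat_mult of_nat_sum)
  qed
qed

end
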